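(* Let $\Gamma\subset\overline{\mathbb{Q}}^*$ be a finitely generated subgroup, let $N\geq1$ be an integer, and let $(y_n)$ be a sequence of elements of $l_N(\Gamma)$. Assume that $d_{\Gamma,\varepsilon}(y_n)\to1$ as $n\to+\infty$ for every $\varepsilon>0$. Then for every $\varepsilon>0$ one has $d_{\Gamma,\varepsilon}(y_n)=1$ for all $n$ large enough.
   Context: Fix an embedding $\overline{\mathbb{Q}}\subset\mathbb{C}$. The division group $\Gamma_{\mathrm{div}}$ is the set of $\gamma\in\overline{\mathbb{Q}}^*$ with $\gamma^n\in\Gamma$ for some integer $n\geq1$. Let $\mu_\infty$ be the set of all roots of unity and $K_\Gamma=\mathbb{Q}(\mu_\infty,\Gamma)$. The length of $x\in\mathbb{Q}(\Gamma_{\mathrm{div}})$ is the smallest integer $l\geq1$ such that $x=\sum_{j=1}^l x_j\gamma_j$ with $x_j\in K_\Gamma$ and $\gamma_j\in\Gamma_{\mathrm{div}}$; $l_N(\Gamma)$ is the set of elements of $\mathbb{Q}(\Gamma_{\mathrm{div}})$ of length $\leq N$. For $\alpha\in\overline{\mathbb{Q}}$, $O_\Gamma(\alpha)$ is the orbit of $\alpha$ under $\mathrm{Gal}(\overline{\mathbb{Q}}/K_\Gamma)$ and, for $\varepsilon>0$, $d_{\Gamma,\varepsilon}(\alpha)=\#\{x\in O_\Gamma(\alpha):1-\varepsilon\leq|x|^2\leq1+\varepsilon\}/\#O_\Gamma(\alpha)$. *)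

theory Defs
  imports
    "HOL-Analysis.Analysis"
    "HOL-Algebra.Generated_Groups"
    "HOL-Algebra.Generated_Fields"
    "HOL-Algebra.QuotRing"
    "HOL-Algebra.Algebraic_Closure_Type"
begin

(* The algebraic closure of the rationals, realised inside the complex numbers. Every embedding
   of an algebraic closure of the rationals into the complex numbers has this image. *)
definition Qbar :: "complex ring" where
  "Qbar = ring_of_type_algebra\<lparr>carrier := {z. algebraic z}\<rparr>"

definition Qbar_star :: "complex monoid" where
  "Qbar_star = Multiplicative_Group.mult_of Qbar"

definition fin_gen_subgroup :: "'a set \<Rightarrow> ('a, 'b) monoid_scheme \<Rightarrow> bool" where
  "fin_gen_subgroup H G \<longleftrightarrow> subgroup H G \<and> (\<exists>S. finite S \<and> S \<subseteq> carrier G \<and> H = generate G S)"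

(* The field generated over the rationals by S. *)
definition Q_adjoin :: "complex set \<Rightarrow> complex set" where
  "Q_adjoin S = generate_field Qbar (\<rat> \<union> S)"

definition div_group :: "complex set \<Rightarrow> complex set" where
  "div_group \<Gamma> = {\<gamma> \<in> carrier Qbar_star. \<exists>n::nat. n \<ge> 1 \<and> \<gamma> ^ n \<in> \<Gamma>}"

definition roots_of_unity :: "complex set" where
  "roots_of_unity = {z. \<exists>n::nat. n \<ge> 1 \<and> z ^ n = 1}"

definition K_field :: "complex set \<Rightarrow> complex set" where
  "K_field \<Gamma> = Q_adjoin (roots_of_unity \<union> \<Gamma>)"

(* For x in Q_adjoin (div_group \<Gamma>) a decomposition always exists: the elements of div_group \<Gamma>
   are algebraic, so this field is the linear span of div_group \<Gamma> over K_field \<Gamma>. *)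
definition gamma_length :: "complex set \<Rightarrow> complex \<Rightarrow> nat" where
  "gamma_length \<Gamma> x = (LEAST l. l \<ge> 1 \<and>
     (\<exists>a g. (\<forall>j\<in>{1..l}. a j \<in> K_field \<Gamma> \<and> g j \<in> div_group \<Gamma>) \<and> x = (\<Sum>j=1..l. a j * g j)))"

definition length_le :: "nat \<Rightarrow> complex set \<Rightarrow> complex set" where
  "length_le N \<Gamma> = {x \<in> Q_adjoin (div_group \<Gamma>). gamma_length \<Gamma> x \<le> N}"

(* Automorphisms are functions on the whole type of complex numbers; only their values on the
   algebraic numbers are constrained or used. *)
definition Gal_Qbar :: "complex set \<Rightarrow> (complex \<Rightarrow> complex) set" where
  "Gal_Qbar K = {\<sigma> \<in> ring_iso Qbar Qbar. \<forall>x\<in>K. \<sigma> x = x}"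

definition gamma_orbit :: "complex set \<Rightarrow> complex \<Rightarrow> complex set" where
  "gamma_orbit \<Gamma> \<alpha> = {\<sigma> \<alpha> | \<sigma>. \<sigma> \<in> Gal_Qbar (K_field \<Gamma>)}"

definition gamma_density :: "complex set \<Rightarrow> real \<Rightarrow> complex \<Rightarrow> real" where
  "gamma_density \<Gamma> \<epsilon> \<alpha> =
     real (card {x \<in> gamma_orbit \<Gamma> \<alpha>. 1 - \<epsilon> \<le> (cmod x)\<^sup>2 \<and> (cmod x)\<^sup>2 \<le> 1 + \<epsilon>})
     / real (card (gamma_orbit \<Gamma> \<alpha>))"

end

theory Submission
  imports Defs
begin

text \<open>
  Let \<open>x = \<Sum>j. a j * g j\<close> have length at most \<open>N\<close>. An automorphism \<open>s\<close> over \<open>K_field \<Gamma>\<close> multiplies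
  each \<open>g j\<close> by a root of unity, and since \<open>K_field \<Gamma>\<close> contains the roots of unity this factor
  is a character of the Galois group. So \<open>s \<mapsto> |s x|\<^sup>2 - 1\<close> is a linear combination of at most \<open>N\<^sup>2\<close>
  unitary characters. A combination \<open>f\<close> of \<open>M\<close> unitary characters that is bounded by \<open>\<delta>\<close> outside a
  set of density less than \<open>1 / 2 ^ M\<close> is bounded by \<open>2 ^ M * \<delta>\<close> everywhere: induct on \<open>M\<close>, using that
  \<open>f (h s) - c h * f s\<close> no longer involves the character \<open>c\<close>.
\<close>

section \<open>Sums of unitary characters that are small at most points\<close>

text \<open>The set \<open>G\<close> may be infinite, so density is counted in the finite image of
  \<open>\<phi>\<close>, on which \<open>G\<close> acts transitively by injective maps. Each
  induction step doubles the bound and adds \<open>\<delta>\<close>, which turns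
  \<open>2 ^ (M - 1) - 1\<close> into \<open>2 ^ M - 1\<close>.\<close>

lemma norm_char_sum_le:
  fixes g :: "'g \<Rightarrow> complex" and c :: "'i \<Rightarrow> 'g \<Rightarrow> complex" and mul :: "'g \<Rightarrow> 'g \<Rightarrow> 'g"
    and \<phi> :: "'g \<Rightarrow> 'a" and act :: "'g \<Rightarrow> 'a \<Rightarrow> 'a"
  assumes mul: "\<And>h s. h \<in> G \<Longrightarrow> s \<in> G \<Longrightarrow> mul h s \<in> G"
    and equiv: "\<And>h s. h \<in> G \<Longrightarrow> s \<in> G \<Longrightarrow> \<phi> (mul h s) = act h (\<phi> s)"
    and inj: "\<And>h. h \<in> G \<Longrightarrow> inj_on (act h) (\<phi> ` G)"
    and trans: "\<And>s t. s \<in> G \<Longrightarrow> t \<in> G \<Longrightarrow> \<exists>h\<in>G. act h (\<phi> s) = \<phi> t"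
    and fin: "finite (\<phi> ` G)"
    and "finite I"
    and "\<And>i h s. i \<in> I \<Longrightarrow> h \<in> G \<Longrightarrow> s \<in> G \<Longrightarrow> c i (mul h s) = c i h * c i s"
    and "\<And>i h. i \<in> I \<Longrightarrow> h \<in> G \<Longrightarrow> cmod (c i h) = 1"
    and "\<And>s. s \<in> G \<Longrightarrow> g s = (\<Sum>i\<in>I. b i * c i s)"
    and "B \<subseteq> \<phi> ` G" "2 ^ card I * card B < card (\<phi> ` G)"
    and "\<And>s. s \<in> G \<Longrightarrow> \<phi> s \<notin> B \<Longrightarrow> cmod (g s) \<le> \<delta>"
    and "s \<in> G"
  shows "cmod (g s) \<le> (2 ^ card I - 1) * \<delta>"
  using assms(6-)
proof (induction I arbitrary: g b B \<delta> s rule: finite_induct)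
  case empty
  then show ?case by simp
next
  case (insert k I)
  have finB: "finite B" using insert.prems(4) fin finite_subset by blast
  \<comment> \<open>The exceptional set \<open>B\<close> is not the whole image, so some
    \<open>h\<close> moves the given point \<open>\<phi> s\<close> to a point
    \<open>\<phi> t\<close> outside \<open>B\<close>. This bounds \<open>g\<close> at
    \<open>mul h s\<close>.\<close>
  have "card B < card (\<phi> ` G)"
  proof -
    have "1 * card B \<le> 2 ^ card (insert k I) * card B" by (rule mult_le_mono1) simp
    then show ?thesis using insert.prems(5) by linarith
  qed
  then have "B \<subset> \<phi> ` G" using insert.prems(4) by auto
  then obtain t where t: "t \<in> G" "\<phi> t \<notin> B" by blast
  obtain h where h: "h \<in> G" "act h (\<phi> s) = \<phi> t"
    using trans[OF insert.prems(7) t(1)] by blast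
  \<comment> \<open>The coefficient of \<open>c i\<close> gets multiplied by
    \<open>c i h - c k h\<close>, which vanishes at \<open>i = k\<close>.\<close>
  define g' where "g' = (\<lambda>s. g (mul h s) - c k h * g s)"
  \<comment> \<open>A point is exceptional for \<open>g'\<close> if it or its image under
    \<open>act h\<close> is exceptional for \<open>g\<close>. By injectivity \<open>B'\<close> is at
    most twice as large as \<open>B\<close>; the factor 2 is absorbed because \<open>I\<close> has
    one index fewer than \<open>insert k I\<close>.\<close>
  define B' where "B' = B \<union> {x \<in> \<phi> ` G. act h x \<in> B}"
  have "card {x \<in> \<phi> ` G. act h x \<in> B} \<le> card B"
    by (rule card_inj_on_le[of "act h"]) (auto intro: inj_on_subset[OF inj[OF h(1)]] simp: finB)
  then have cardB': "card B' \<le> 2 * card B"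
    unfolding B'_def using card_Un_le[of B "{x \<in> \<phi> ` G. act h x \<in> B}"] by linarith
  have "cmod (g' s) \<le> (2 ^ card I - 1) * (2 * \<delta>)"
  proof (rule insert.IH[where B = B' and b = "\<lambda>i. b i * (c i h - c k h)"])
    show "g' s = (\<Sum>i\<in>I. b i * (c i h - c k h) * c i s)" if "s \<in> G" for s
      using that h(1) insert.hyps insert.prems(1)
      by (simp add: g'_def insert.prems(3) mul ring_distribs sum_distrib_left
          flip: sum_subtractf) (auto intro!: sum.cong simp: algebra_simps)
    show "2 ^ card I * card B' < card (\<phi> ` G)"
    proof -
      have "2 ^ card I * card B' \<le> 2 ^ card I * (2 * card B)"
        using cardB' by (rule mult_le_mono2)
      also have "\<dots> < card (\<phi> ` G)" using insert.prems(5) insert.hyps by simp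
      finally show ?thesis .
    qed
    show "cmod (g' s) \<le> 2 * \<delta>" if "s \<in> G" "\<phi> s \<notin> B'" for s
    proof -
      have "cmod (g s) \<le> \<delta>" "cmod (g (mul h s)) \<le> \<delta>"
        using that h(1) by (auto simp: B'_def equiv intro!: insert.prems(6) mul)
      moreover have "cmod (g' s) \<le> cmod (g (mul h s)) + cmod (c k h * g s)"
        unfolding g'_def by (rule norm_triangle_ineq4)
      ultimately show ?thesis
        using insert.prems(2)[of k h] h(1) by (simp add: norm_mult)
    qed
  qed (use insert.prems in \<open>auto simp: B'_def\<close>)
  moreover have "cmod (g (mul h s)) \<le> \<delta>"
    using insert.prems(7) h t by (intro insert.prems(6)) (auto simp: mul equiv)
  \<comment> \<open>As \<open>c k h\<close> has modulus 1, the bound passes back to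
    \<open>g s\<close>: the product \<open>c k h * g s\<close> is the difference of
    \<open>g (mul h s)\<close> and \<open>g' s\<close>, both already bounded.\<close>
  moreover have "cmod (g s) = cmod (c k h * g s)"
    using insert.prems(2)[of k h] h(1) by (simp add: norm_mult)
  moreover have "cmod (c k h * g s) \<le> cmod (g (mul h s)) + cmod (g' s)"
    unfolding g'_def by (metis norm_minus_commute norm_triangle_sub)
  ultimately have "cmod (g s) \<le> \<delta> + (2 ^ card I - 1) * (2 * \<delta>)" by linarith
  then show ?case using insert.hyps by (simp add: algebra_simps)
qed

section \<open>The complex numbers as an algebraic structure with carrier\<close>

abbreviation CC :: "complex ring" where "CC \<equiv> ring_of_type_algebra"

lemma CC_simps [simp]: "carrier CC = UNIV" "x \<otimes>\<^bsub>CC\<^esub> y = x * y" "x \<oplus>\<^bsub>CC\<^esub> y = x + y"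
  "\<zero>\<^bsub>CC\<^esub> = 0" "\<one>\<^bsub>CC\<^esub> = 1"
  by (simp_all add: ring_of_type_algebra_def)

interpretation CC: cring CC
  by (rule cring_from_type_algebra)

lemma field_CC: "field CC"
  by (rule field_from_type_algebra)

lemma CC_a_inv [simp]: "\<ominus>\<^bsub>CC\<^esub> x = - x"
  using CC.minus_equality[of "- x" x] by simp

lemma CC_m_inv [simp]: "x \<noteq> 0 \<Longrightarrow> inv\<^bsub>CC\<^esub> x = inverse x"
  using CC.comm_inv_char[of x "inverse x"] by simp

lemma CC_nat_pow [simp]: "x [^]\<^bsub>CC\<^esub> (n::nat) = x ^ n"
  by (induction n) simp_all

text \<open>Polynomials of the structure are lists with the leading coefficient first, while
  \<open>Poly\<close> reads the constant term first; hence \<open>rev\<close>.\<close>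

lemma CC_eval: "CC.eval p x = poly (Poly (rev p)) x"
  by (induction p) (simp_all add: Poly_append poly_monom algebra_simps)

lemma subfield_Rats: "subfield \<rat> CC"
  by (rule field.subfieldI'[OF field_CC]) (auto intro!: CC.subringI)

text \<open>A bridge between the two notions of algebraic number. It imports the fact that the
  elements algebraic over a subfield form a subfield, which makes \<open>Qbar\<close> a
  field.\<close>

lemma algebraic_iff_CC: "algebraic x \<longleftrightarrow> (CC.algebraic over \<rat>) x"
proof
  assume "algebraic x"
  then obtain p where p: "\<And>i. Polynomial.coeff p i \<in> \<rat>" "p \<noteq> 0" "poly p x = 0"
    unfolding algebraic_altdef by blast
  show "(CC.algebraic over \<rat>) x"
  proof (rule CC.algebraicI)
    show "rev (coeffs p) \<in> carrier (\<rat>[X]\<^bsub>CC\<^esub>)"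
      using p(1,2) by (auto simp: hd_rev last_coeffs_eq_coeff_degree coeffs_def
          simp flip: univ_poly_carrier intro!: polynomial_def[THEN iffD2])
  qed (use p in \<open>simp_all add: CC_eval\<close>)
next
  assume "(CC.algebraic over \<rat>) x"
  then obtain p where p: "p \<in> carrier (\<rat>[X]\<^bsub>CC\<^esub>)" "p \<noteq> []" "CC.eval p x = 0"
    using domain.algebraicE[OF field.axioms(1)[OF field_CC] subfieldE(1)[OF subfield_Rats], of x] by auto
  then have p': "set p \<subseteq> \<rat>" "hd p \<noteq> 0"
    by (auto simp: polynomial_def simp flip: univ_poly_carrier)
  show "algebraic x"
  proof (rule algebraicI')
    show "Polynomial.coeff (Poly (rev p)) i \<in> \<rat>" for i
    proof (cases "i < length p")
      case True
      then have "rev p ! i \<in> set p" by (metis length_rev nth_mem set_rev)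
      then show ?thesis using p'(1) True by (auto simp: nth_default_def)
    qed (simp add: nth_default_def)
    \<comment> \<open>The head of the list becomes the top coefficient. It is nonzero by the normal
      form of list polynomials, so the translated polynomial is not zero.\<close>
    have "Polynomial.coeff (Poly (rev p)) (length p - 1) = hd p"
      using p(2) by (simp add: nth_default_def rev_nth hd_conv_nth)
    then show "Poly (rev p) \<noteq> 0" using p'(2) by force
    show "poly (Poly (rev p)) x = 0" using p(3) by (simp add: CC_eval)
  qed
qed

section \<open>Algebraic numbers and the fields they generate\<close>

lemma Qbar_simps [simp]: "carrier Qbar = {z. algebraic z}" "x \<otimes>\<^bsub>Qbar\<^esub> y = x * y"
  "x \<oplus>\<^bsub>Qbar\<^esub> y = x + y" "\<zero>\<^bsub>Qbar\<^esub> = 0" "\<one>\<^bsub>Qbar\<^esub> = 1"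
  by (simp_all add: Qbar_def)

lemma field_Qbar: "field Qbar"
proof -
  have "subfield {z. algebraic z} CC"
    using field.subfield_of_algebraics[OF field_CC subfield_Rats] by (simp add: algebraic_iff_CC)
  then show "field Qbar" unfolding Qbar_def by (rule CC.subfield_iff)
qed

interpretation Qbar: cring Qbar
  using field_Qbar by (simp add: fieldE(1))

lemma algebraic_add: "algebraic x \<Longrightarrow> algebraic y \<Longrightarrow> algebraic (x + y)" for x y :: complex
  using Qbar.a_closed[of x y] by simp

lemma algebraic_mult: "algebraic x \<Longrightarrow> algebraic y \<Longrightarrow> algebraic (x * y)" for x y :: complex
  using Qbar.m_closed[of x y] by simp

lemma algebraic_sum: "(\<And>i. i \<in> A \<Longrightarrow> algebraic (f i)) \<Longrightarrow> algebraic (\<Sum>i\<in>A. f i)"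
  for f :: "'a \<Rightarrow> complex"
  by (induction A rule: infinite_finite_induct) (auto intro: algebraic_add)

lemma Qbar_a_inv: "algebraic x \<Longrightarrow> \<ominus>\<^bsub>Qbar\<^esub> x = - x"
  using Qbar.minus_equality[of "- x" x] by simp

lemma Qbar_m_inv: "algebraic x \<Longrightarrow> x \<noteq> 0 \<Longrightarrow> inv\<^bsub>Qbar\<^esub> x = inverse x"
  using Qbar.comm_inv_char[of x "inverse x"] by (simp add: algebraic_inverse)

lemma Q_adjoin_subset:
  assumes "S \<subseteq> {z. algebraic z}"
  shows "Q_adjoin S \<subseteq> {z. algebraic z}"
  unfolding Q_adjoin_def using assms field.generate_field_incl[OF field_Qbar, of "\<rat> \<union> S"]
  by (auto intro: rat_imp_algebraic)

lemma Q_adjoin_incl: "S \<subseteq> Q_adjoin S"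
  unfolding Q_adjoin_def by (auto intro: generate_field.incl)

lemma Rats_subset_Q_adjoin: "\<rat> \<subseteq> Q_adjoin S"
  unfolding Q_adjoin_def by (auto intro: generate_field.incl)

lemma Q_adjoin_mult: "x \<in> Q_adjoin S \<Longrightarrow> y \<in> Q_adjoin S \<Longrightarrow> x * y \<in> Q_adjoin S"
  unfolding Q_adjoin_def using generate_field.eng_mult[of x Qbar "\<rat> \<union> S" y] by simp

text \<open>A nonzero algebraic \<open>v\<close> is a root of an integer polynomial
  \<open>c + X * q\<close> with \<open>c \<noteq> 0\<close>, so its inverse is
  \<open>- q(v) / c\<close>, a polynomial in \<open>v\<close> over the rationals. Thus a ring of
  algebraic numbers containing the rationals is a field.\<close>

lemma Rats_subring_inverse:
  fixes V :: "complex set"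
  assumes Q: "\<rat> \<subseteq> V" and add: "\<And>x y. x \<in> V \<Longrightarrow> y \<in> V \<Longrightarrow> x + y \<in> V"
    and mult: "\<And>x y. x \<in> V \<Longrightarrow> y \<in> V \<Longrightarrow> x * y \<in> V"
    and v: "v \<in> V" "algebraic v" "v \<noteq> 0"
  shows "inverse v \<in> V"
proof -
  obtain p :: "int poly" where p: "Polynomial.coeff p 0 \<noteq> 0" "poly (map_poly of_int p) v = 0"
    using algebraicE'_nonzero[OF v(2,3)] by blast
  obtain c q where pq: "p = pCons c q" by (cases p)
  have poly_in: "poly (map_poly of_int r) v \<in> V" for r :: "int poly"
  proof (induction r)
    case 0
    then show ?case using Q by auto
  next
    case (pCons a r)
    then show ?case using Q v(1) by (auto simp: map_poly_pCons intro!: add mult)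
  qed
  have "of_int c + v * poly (map_poly of_int q) v = 0"
    using p(2) by (simp add: pq map_poly_pCons)
  then have "inverse v = of_rat (- 1 / of_int c) * poly (map_poly of_int q) v"
    using v(3) p(1) by (simp add: pq field_simps of_rat_divide of_rat_minus eq_neg_iff_add_eq_0)
  then show ?thesis using Q poly_in[of q] by (auto intro!: mult)
qed

section \<open>Linear spans of the division group and the length\<close>

text \<open>The finite nonempty sums of products, given by closure rules so that products can be
  handled by induction without indices.\<close>

inductive_set product_span :: "'a::comm_ring_1 set \<Rightarrow> 'a set \<Rightarrow> 'a set" for K D where
  prod: "a \<in> K \<Longrightarrow> g \<in> D \<Longrightarrow> a * g \<in> product_span K D"
| add: "x \<in> product_span K D \<Longrightarrow> y \<in> product_span K D \<Longrightarrow> x + y \<in> product_span K D"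

lemma product_span_mult:
  assumes "\<And>a b. a \<in> K \<Longrightarrow> b \<in> K \<Longrightarrow> a * b \<in> K" "\<And>a b. a \<in> D \<Longrightarrow> b \<in> D \<Longrightarrow> a * b \<in> D"
    and "x \<in> product_span K D" "y \<in> product_span K D"
  shows "x * y \<in> product_span K D"
  using assms(3)
proof induction
  case (prod a g)
  show ?case using assms(4)
  proof induction
    case (prod b h)
    then show ?case
      using product_span.prod[of "a * b" K "g * h" D] assms(1)[of a b] assms(2)[of g h] \<open>a \<in> K\<close> \<open>g \<in> D\<close>
      by (simp add: ac_simps)
  qed (simp add: distrib_left product_span.add)
qed (simp add: distrib_right product_span.add)

lemma product_span_sum:
  assumes "x \<in> product_span K D"
  shows "\<exists>l\<ge>1::nat. \<exists>a g. (\<forall>j\<in>{1..l}. a j \<in> K \<and> g j \<in> D) \<and> x = (\<Sum>j=1..l. a j * g j)"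
  using assms
proof induction
  case (prod a g)
  then show ?case by (intro exI[of _ 1] conjI exI[of _ "\<lambda>_. a"] exI[of _ "\<lambda>_. g"]) auto
next
  case (add x y)
  obtain l :: nat and a g where x: "l \<ge> 1" "\<forall>j\<in>{1..l}. a j \<in> K \<and> g j \<in> D" "x = (\<Sum>j=1..l. a j * g j)"
    using add.IH(1) by (elim exE conjE) (rule that, assumption+)
  obtain m :: nat and b h where y: "m \<ge> 1" "\<forall>j\<in>{1..m}. b j \<in> K \<and> h j \<in> D" "y = (\<Sum>j=1..m. b j * h j)"
    using add.IH(2) by (elim exE conjE) (rule that, assumption+)
  \<comment> \<open>Concatenation of the two families: the second one is shifted by
    \<open>l\<close>, since indices start at 1.\<close>
  define a' where "a' = (\<lambda>j. if j \<le> l then a j else b (j - l))"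
  define g' where "g' = (\<lambda>j. if j \<le> l then g j else h (j - l))"
  have "(\<Sum>j=1..l+m. a' j * g' j) = (\<Sum>j=1..l. a' j * g' j) + (\<Sum>j=l+1..l+m. a' j * g' j)"
    using sum.ub_add_nat[of 1 l "\<lambda>j. a' j * g' j" m] by simp
  also have "(\<Sum>j=l+1..l+m. a' j * g' j) = (\<Sum>j=1..m. a' (j + l) * g' (j + l))"
    using sum.shift_bounds_cl_nat_ivl[of "\<lambda>j. a' j * g' j" 1 l m] by (simp add: add.commute)
  finally have "x + y = (\<Sum>j=1..l+m. a' j * g' j)"
    unfolding x(3) y(3) by (auto simp: a'_def g'_def intro!: arg_cong2[of _ _ _ _ "(+)"] sum.cong)
  moreover have "\<forall>j\<in>{1..l+m}. a' j \<in> K \<and> g' j \<in> D"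
  proof
    fix j assume j: "j \<in> {1..l+m}"
    show "a' j \<in> K \<and> g' j \<in> D"
    proof (cases "j \<le> l")
      case True
      then show ?thesis using j x(2) by (simp add: a'_def g'_def)
    next
      case False
      then have "j - l \<in> {1..m}" using j by auto
      then show ?thesis using False y(2) by (simp add: a'_def g'_def)
    qed
  qed
  ultimately show ?case using x(1) by (intro exI[of _ "l+m"] conjI exI[of _ a'] exI[of _ g']) auto
qed

context
  fixes \<Gamma> :: "complex set"
  assumes \<Gamma>: "subgroup \<Gamma> Qbar_star"
begin

lemma Gamma_algebraic: "\<Gamma> \<subseteq> {z. algebraic z}"
  using subgroup.subset[OF \<Gamma>] by (auto simp: Qbar_star_def)

lemma Gamma_power: "x \<in> \<Gamma> \<Longrightarrow> x ^ n \<in> \<Gamma>"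
  by (induction n) (use subgroup.one_closed[OF \<Gamma>] subgroup.m_closed[OF \<Gamma>] in \<open>simp_all add: Qbar_star_def\<close>)

lemma div_groupD: "\<gamma> \<in> div_group \<Gamma> \<Longrightarrow> algebraic \<gamma> \<and> \<gamma> \<noteq> 0"
  by (auto simp: div_group_def Qbar_star_def)

lemma one_in_div_group: "1 \<in> div_group \<Gamma>"
  using subgroup.one_closed[OF \<Gamma>] by (auto simp: div_group_def Qbar_star_def intro!: exI[of _ 1])

lemma div_group_mult:
  assumes "\<gamma> \<in> div_group \<Gamma>" "\<delta> \<in> div_group \<Gamma>"
  shows "\<gamma> * \<delta> \<in> div_group \<Gamma>"
proof -
  obtain m n where mn: "m \<ge> 1" "n \<ge> 1" "\<gamma> ^ m \<in> \<Gamma>" "\<delta> ^ n \<in> \<Gamma>"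
    using assms by (auto simp: div_group_def)
  have "(\<gamma> * \<delta>) ^ (m * n) = (\<gamma> ^ m) ^ n * (\<delta> ^ n) ^ m"
    by (simp add: power_mult_distrib mult.commute flip: power_mult)
  then have "(\<gamma> * \<delta>) ^ (m * n) \<in> \<Gamma>"
    using subgroup.m_closed[OF \<Gamma> Gamma_power[OF mn(3), of n] Gamma_power[OF mn(4), of m]]
    by (simp add: Qbar_star_def)
  moreover have "m * n \<ge> 1" using mn by simp
  ultimately show ?thesis
    using div_groupD[OF assms(1)] div_groupD[OF assms(2)]
    by (auto simp: div_group_def Qbar_star_def intro!: algebraic_mult exI[of _ "m * n"])
qed

lemma K_field_algebraic: "K_field \<Gamma> \<subseteq> {z. algebraic z}"
  unfolding K_field_def
proof (rule Q_adjoin_subset)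
  have "algebraic z" if "z ^ n = 1" "n \<ge> 1" for z :: complex and n
    using that by (intro algebraicI[of "Polynomial.monom 1 n - 1"])
      (auto simp: poly_monom coeff_1 monom_eq_1_iff simp flip: one_poly_def)
  then show "roots_of_unity \<union> \<Gamma> \<subseteq> {z. algebraic z}"
    using Gamma_algebraic by (auto simp: roots_of_unity_def)
qed

text \<open>The span contains the rationals and the division group, is closed under sums and
  products, and consists of algebraic numbers, hence is also closed under inverses. So every element
  of the generated field has a decomposition, and its length is meaningful.\<close>

lemma Q_adjoin_div_group: "Q_adjoin (div_group \<Gamma>) \<subseteq> product_span (K_field \<Gamma>) (div_group \<Gamma>)"
proof
  let ?V = "product_span (K_field \<Gamma>) (div_group \<Gamma>)"
  have Q: "\<rat> \<subseteq> ?V"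
  proof
    fix q :: complex assume "q \<in> \<rat>"
    then have "q \<in> K_field \<Gamma>" using Rats_subset_Q_adjoin by (auto simp: K_field_def)
    from product_span.prod[OF this one_in_div_group] show "q \<in> ?V" by simp
  qed
  have 1: "1 \<in> K_field \<Gamma>" unfolding K_field_def by (rule subsetD[OF Rats_subset_Q_adjoin]) simp
  have mult: "x * y \<in> ?V" if "x \<in> ?V" "y \<in> ?V" for x y
    using that by (intro product_span_mult div_group_mult) (auto simp: K_field_def intro: Q_adjoin_mult)
  have alg: "algebraic x" if "x \<in> ?V" for x
    using that K_field_algebraic by induction (auto intro!: algebraic_add algebraic_mult dest: div_groupD)
  fix x assume "x \<in> Q_adjoin (div_group \<Gamma>)"
  then show "x \<in> ?V" unfolding Q_adjoin_def
  proof induction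
    case one
    then show ?case using Q by auto
  next
    case (incl h)
    then show ?case using Q product_span.prod[OF 1, of h] by auto
  next
    case (a_inv h)
    moreover have "- 1 \<in> ?V" using Q by auto
    ultimately show ?case using mult[of "- 1" h] by (simp add: Qbar_a_inv alg)
  next
    case (m_inv h)
    then show ?case
      using Rats_subring_inverse[OF Q product_span.add mult, of h] by (simp add: Qbar_m_inv alg)
  qed (auto intro: product_span.add mult)
qed

lemma length_leE:
  assumes "x \<in> length_le N \<Gamma>"
  obtains l a g where "l \<le> N" "\<And>j. j \<in> {1..l} \<Longrightarrow> a j \<in> K_field \<Gamma>"
    "\<And>j. j \<in> {1..l} \<Longrightarrow> g j \<in> div_group \<Gamma>" "l \<ge> 1" "x = (\<Sum>j=1..l. a j * g j)"
proof -
  let ?P = "\<lambda>l::nat. l \<ge> 1 \<and> (\<exists>a g. (\<forall>j\<in>{1..l}. a j \<in> K_field \<Gamma> \<and> g j \<in> div_group \<Gamma>)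
    \<and> x = (\<Sum>j=1..l. a j * g j))"
  have "x \<in> product_span (K_field \<Gamma>) (div_group \<Gamma>)"
    using assms Q_adjoin_div_group by (auto simp: length_le_def)
  then have "\<exists>l. ?P l" by (rule product_span_sum)
  \<comment> \<open>Since some decomposition exists, the \<open>LEAST\<close> in the length is
    attained.\<close>
  then have "?P (gamma_length \<Gamma> x)" unfolding gamma_length_def by (rule LeastI_ex)
  moreover have "gamma_length \<Gamma> x \<le> N" using assms by (simp add: length_le_def)
  ultimately show thesis using that by blast
qed

end

section \<open>Automorphisms over \<open>K_field \<Gamma>\<close> and their characters on the
  division group\<close>

lemma GalD:
  assumes "s \<in> Gal_Qbar K"
  shows "algebraic x \<Longrightarrow> algebraic (s x)"
    and "algebraic x \<Longrightarrow> algebraic y \<Longrightarrow> s (x + y) = s x + s y"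
    and "algebraic x \<Longrightarrow> algebraic y \<Longrightarrow> s (x * y) = s x * s y"
    and "s 1 = 1" and "x \<in> K \<Longrightarrow> s x = x" and "bij_betw s {z. algebraic z} {z. algebraic z}"
  using assms ring_iso_memE[of s Qbar Qbar] by (auto simp: Gal_Qbar_def)

lemma Gal_sum:
  assumes "s \<in> Gal_Qbar K" "\<And>i. i \<in> A \<Longrightarrow> algebraic (f i)"
  shows "s (\<Sum>i\<in>A. f i) = (\<Sum>i\<in>A. s (f i))"
proof -
  have "s 0 = 0" using GalD(2)[OF assms(1), of 0 0] by simp
  then show ?thesis using assms(2)
    by (induction A rule: infinite_finite_induct) (simp_all add: GalD(2)[OF assms(1)] algebraic_sum)
qed

lemma Gal_power: "s \<in> Gal_Qbar K \<Longrightarrow> algebraic x \<Longrightarrow> algebraic (x ^ n) \<and> s (x ^ n) = s x ^ n"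
  by (induction n) (simp_all add: GalD algebraic_mult)

lemma Gal_id: "id \<in> Gal_Qbar K"
  by (auto simp: Gal_Qbar_def intro!: ring_iso_memI)

lemma Gal_comp: "h \<in> Gal_Qbar K \<Longrightarrow> s \<in> Gal_Qbar K \<Longrightarrow> h \<circ> s \<in> Gal_Qbar K"
  by (auto simp: Gal_Qbar_def intro: ring_iso_set_trans)

text \<open>Automorphisms are bijective only on the algebraic numbers, so the inverse is taken
  relative to that set. It serves to show transitivity on orbits.\<close>

lemma Gal_inv:
  assumes "s \<in> Gal_Qbar K" "K \<subseteq> {z. algebraic z}"
  shows "inv_into {z. algebraic z} s \<in> Gal_Qbar K"
proof -
  have "inv_into {z. algebraic z} s x = x" if "x \<in> K" for x
    using that assms(2) GalD(5,6)[OF assms(1)] by (auto intro!: inv_into_f_eq simp: bij_betw_def)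
  moreover have "inv_into {z. algebraic z} s \<in> ring_iso Qbar Qbar"
    using ring_iso_set_sym[OF Qbar.ring_axioms, of s Qbar] assms(1) by (simp add: Gal_Qbar_def)
  ultimately show ?thesis by (simp add: Gal_Qbar_def)
qed

text \<open>Some power \<open>\<gamma> ^ n\<close> lies in \<open>\<Gamma>\<close> and is fixed by
  \<open>s\<close>, so \<open>s \<gamma> / \<gamma>\<close> is an \<open>n\<close>-th root of unity,
  and these lie in \<open>K_field \<Gamma>\<close>.\<close>

lemma Gal_div_group:
  assumes \<Gamma>: "subgroup \<Gamma> Qbar_star" and \<gamma>: "\<gamma> \<in> div_group \<Gamma>" and s: "s \<in> Gal_Qbar (K_field \<Gamma>)"
  obtains z n where "n \<ge> 1" "\<gamma> ^ n \<in> \<Gamma>" "z \<in> K_field \<Gamma>" "z ^ n = 1" "s \<gamma> = z * \<gamma>"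
proof -
  obtain n where n: "n \<ge> 1" "\<gamma> ^ n \<in> \<Gamma>" using \<gamma> by (auto simp: div_group_def)
  have incl: "roots_of_unity \<union> \<Gamma> \<subseteq> K_field \<Gamma>" unfolding K_field_def by (rule Q_adjoin_incl)
  have alg: "algebraic \<gamma>" "\<gamma> \<noteq> 0" using div_groupD[OF \<Gamma> \<gamma>] by auto
  have "s \<gamma> ^ n = \<gamma> ^ n"
    using Gal_power[OF s alg(1), of n] GalD(5)[OF s] n(2) incl by (metis UnI2 subsetD)
  then have "(s \<gamma> / \<gamma>) ^ n = 1" using alg(2) by (simp add: power_divide)
  then show thesis
    using that[of n "s \<gamma> / \<gamma>"] n alg(2) incl by (auto simp: roots_of_unity_def)
qed

text \<open>The Kummer argument: \<open>s \<gamma> / \<gamma>\<close> is a root of unity in the base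
  field, hence fixed by \<open>h\<close>, and so \<open>h\<close> applied to
  \<open>s \<gamma>\<close> just multiplies \<open>h \<gamma>\<close> by it.\<close>

lemma Gal_character_mult:
  assumes "subgroup \<Gamma> Qbar_star" "\<gamma> \<in> div_group \<Gamma>"
    and h: "h \<in> Gal_Qbar (K_field \<Gamma>)" and s: "s \<in> Gal_Qbar (K_field \<Gamma>)"
  shows "(h \<circ> s) \<gamma> / \<gamma> = h \<gamma> / \<gamma> * (s \<gamma> / \<gamma>)"
proof -
  obtain z where z: "z \<in> K_field \<Gamma>" "s \<gamma> = z * \<gamma>"
    using Gal_div_group[OF assms(1,2) s] by metis
  have "h (z * \<gamma>) = h z * h \<gamma>"
    using z(1) K_field_algebraic[OF assms(1)] div_groupD[OF assms(1,2)] by (intro GalD(3)[OF h]) auto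
  then show ?thesis using GalD(5)[OF h z(1)] z(2) by (simp add: field_simps)
qed

lemma Gal_character_norm:
  assumes "subgroup \<Gamma> Qbar_star" "\<gamma> \<in> div_group \<Gamma>" "s \<in> Gal_Qbar (K_field \<Gamma>)"
  shows "cmod (s \<gamma> / \<gamma>) = 1"
proof -
  obtain z n where z: "n \<ge> 1" "z ^ n = 1" "s \<gamma> = z * \<gamma>"
    using Gal_div_group[OF assms] by metis
  then have "cmod z = 1" using power_eq_1_iff[of z n] by auto
  then show ?thesis using z(3) div_groupD[OF assms(1,2)] by (simp add: norm_mult norm_divide)
qed

section \<open>Finiteness and rigidity of orbits\<close>

lemma gamma_orbit_eq: "gamma_orbit \<Gamma> x = (\<lambda>s. s x) ` Gal_Qbar (K_field \<Gamma>)"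
  by (auto simp: gamma_orbit_def)

lemma
  assumes \<Gamma>: "subgroup \<Gamma> Qbar_star" and x: "x \<in> length_le N \<Gamma>"
  shows finite_gamma_orbit: "finite (gamma_orbit \<Gamma> x)"
    and gamma_orbit_rigid: "\<lbrakk>2 ^ N\<^sup>2 * card {z \<in> gamma_orbit \<Gamma> x. \<bar>(cmod z)\<^sup>2 - 1\<bar> > \<delta>} < card (gamma_orbit \<Gamma> x);
      \<delta> \<ge> 0; z \<in> gamma_orbit \<Gamma> x\<rbrakk> \<Longrightarrow> \<bar>(cmod z)\<^sup>2 - 1\<bar> \<le> 2 ^ N\<^sup>2 * \<delta>"
proof -
  let ?G = "Gal_Qbar (K_field \<Gamma>)" and ?O = "gamma_orbit \<Gamma> x"
  obtain l a g where l: "l \<le> N" "l \<ge> 1" and a: "\<And>j. j \<in> {1..l} \<Longrightarrow> a j \<in> K_field \<Gamma>"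
    and g: "\<And>j. j \<in> {1..l} \<Longrightarrow> g j \<in> div_group \<Gamma>" and x_eq: "x = (\<Sum>j=1..l. a j * g j)"
    using length_leE[OF \<Gamma> x] by metis
  have a_alg: "algebraic (a j)" and g_alg: "algebraic (g j)" and g0: "g j \<noteq> 0" if "j \<in> {1..l}" for j
    using K_field_algebraic[OF \<Gamma>] a[OF that] div_groupD[OF \<Gamma> g[OF that]] by auto
  have x_alg: "algebraic x" unfolding x_eq by (intro algebraic_sum algebraic_mult a_alg g_alg)
  have sx: "s x = (\<Sum>j=1..l. a j * s (g j))" if "s \<in> ?G" for s
  proof -
    have "s x = (\<Sum>j=1..l. s (a j * g j))"
      unfolding x_eq by (intro Gal_sum[OF that] algebraic_mult a_alg g_alg)
    also have "\<dots> = (\<Sum>j=1..l. a j * s (g j))"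
      by (intro sum.cong refl) (simp add: GalD(3)[OF that a_alg g_alg] GalD(5)[OF that a])
    finally show ?thesis .
  qed
  have "\<forall>j\<in>{1..l}. \<exists>n\<ge>1. g j ^ n \<in> \<Gamma>" using g by (auto simp: div_group_def)
  then obtain n where n: "\<And>j. j \<in> {1..l} \<Longrightarrow> n j \<ge> 1 \<and> g j ^ n j \<in> \<Gamma>" by metis
  \<comment> \<open>The possible images of the \<open>g j\<close>: each conjugate of
    \<open>g j\<close> is among the finitely many solutions of \<open>w ^ n j = g j ^ n j\<close>,
    and these choices determine the conjugate of \<open>x\<close>.\<close>
  define F where "F = PiE {1..l} (\<lambda>j. {w. w ^ n j = g j ^ n j})"
  have "?O \<subseteq> (\<lambda>f. \<Sum>j=1..l. a j * f j) ` F"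
  proof
    fix z assume "z \<in> ?O"
    then obtain s where s: "s \<in> ?G" "z = s x" by (auto simp: gamma_orbit_eq)
    have "s (g j) ^ n j = g j ^ n j" if "j \<in> {1..l}" for j
    proof -
      have "g j ^ n j \<in> K_field \<Gamma>"
        using n[OF that] Q_adjoin_incl[of "roots_of_unity \<union> \<Gamma>"] by (auto simp: K_field_def)
      then show ?thesis
        using Gal_power[OF s(1) g_alg[OF that], of "n j"] GalD(5)[OF s(1)] by simp
    qed
    then have "restrict (\<lambda>j. s (g j)) {1..l} \<in> F" by (auto simp: F_def)
    moreover have "z = (\<Sum>j=1..l. a j * restrict (\<lambda>j. s (g j)) {1..l} j)"
      using sx[OF s(1)] s(2) by simp
    ultimately show "z \<in> (\<lambda>f. \<Sum>j=1..l. a j * f j) ` F" by blast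
  qed
  moreover have "finite F"
    unfolding F_def using n by (intro finite_PiE finite_nth_roots) force+
  ultimately show fin: "finite ?O" by (meson finite_imageI finite_subset)

  assume card: "2 ^ N\<^sup>2 * card {z \<in> ?O. \<bar>(cmod z)\<^sup>2 - 1\<bar> > \<delta>} < card ?O" and \<delta>: "\<delta> \<ge> 0" and z: "z \<in> ?O"
  obtain s where s: "s \<in> ?G" "z = s x" using z by (auto simp: gamma_orbit_eq)
  define I where "I = {1..l} \<times> {1..l}"
  \<comment> \<open>Expanding \<open>s x * cnj (s x)\<close> over pairs \<open>(i, j)\<close> gives
    the character of \<open>g i\<close> times the conjugate of that of \<open>g j\<close>, since
    \<open>s\<close> fixes the \<open>a j\<close>.\<close>
  define c where "c = (\<lambda>(i, j) s. s (g i) / g i * cnj (s (g j) / g j))"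
  \<comment> \<open>The constant 1 is subtracted from the coefficient at \<open>(1, 1)\<close>,
    whose character is trivial. This uses \<open>l \<ge> 1\<close> and keeps the number of
    characters at \<open>l\<close> squared.\<close>
  define b where "b = (\<lambda>(i, j). a i * g i * cnj (a j * g j) - (if (i, j) = (1::nat, 1::nat) then 1 else 0))"
  have cardI: "card I = l\<^sup>2" by (simp add: I_def power2_eq_square)
  have "card I \<le> N\<^sup>2"
    unfolding cardI using l(1) by (intro power_mono) auto
  then have le: "(2::nat) ^ card I \<le> 2 ^ N\<^sup>2" and le_real: "(2::real) ^ card I \<le> 2 ^ N\<^sup>2"
    by (auto intro: power_increasing)
  have "cmod (of_real ((cmod (s x))\<^sup>2 - 1)) \<le> (2 ^ card I - 1) * \<delta>"
  \<comment> \<open>The image of \<open>\<phi>\<close> is the orbit of \<open>x\<close>, on which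
    each automorphism acts by evaluation.\<close>
  proof (rule norm_char_sum_le[where G = ?G and mul = "(\<circ>)" and \<phi> = "\<lambda>s. s x" and act = "\<lambda>h. h"
        and c = c and b = b and B = "{z \<in> ?O. \<bar>(cmod z)\<^sup>2 - 1\<bar> > \<delta>}"
        and g = "\<lambda>s. of_real ((cmod (s x))\<^sup>2 - 1)"])
    show "inj_on h ((\<lambda>s. s x) ` ?G)" if "h \<in> ?G" for h
      using GalD(6)[OF that] GalD(1)[OF _ x_alg] by (auto simp: bij_betw_def elim!: inj_on_subset)
    show "\<exists>h\<in>?G. h (s x) = t x" if "s \<in> ?G" "t \<in> ?G" for s t
      using Gal_comp[OF that(2) Gal_inv[OF that(1) K_field_algebraic[OF \<Gamma>]]] GalD(6)[OF that(1)] x_alg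
      by (intro bexI[of _ "t \<circ> inv_into {z. algebraic z} s"]) (auto simp: bij_betw_def)
    show "c i (h \<circ> s) = c i h * c i s" if "i \<in> I" "h \<in> ?G" "s \<in> ?G" for i h s
    proof -
      from that(1) obtain p q where i: "i = (p, q)" "p \<in> {1..l}" "q \<in> {1..l}" by (auto simp: I_def)
      show ?thesis
        unfolding i(1) c_def prod.case Gal_character_mult[OF \<Gamma> g[OF i(2)] that(2,3)]
          Gal_character_mult[OF \<Gamma> g[OF i(3)] that(2,3)] complex_cnj_mult by (simp only: ac_simps)
    qed
    show "cmod (c i h) = 1" if "i \<in> I" "h \<in> ?G" for i h
    proof -
      from that(1) obtain p q where i: "i = (p, q)" "p \<in> {1..l}" "q \<in> {1..l}" by (auto simp: I_def)
      show ?thesis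
        unfolding i(1) c_def prod.case norm_mult complex_mod_cnj Gal_character_norm[OF \<Gamma> g[OF i(2)] that(2)]
          Gal_character_norm[OF \<Gamma> g[OF i(3)] that(2)] by simp
    qed
    show "of_real ((cmod (s x))\<^sup>2 - 1) = (\<Sum>i\<in>I. b i * c i s)" if "s \<in> ?G" for s
    proof -
      have "(\<Sum>i\<in>I. b i * c i s) = (\<Sum>i\<in>I. a (fst i) * s (g (fst i)) * cnj (a (snd i) * s (g (snd i)))
          - (if i = (1, 1) then c (1, 1) s else 0))"
        by (intro sum.cong) (auto simp: I_def b_def c_def g0 field_simps split: if_splits)
      also have "\<dots> = (\<Sum>i\<in>I. a (fst i) * s (g (fst i)) * cnj (a (snd i) * s (g (snd i)))) - c (1, 1) s"
        using l by (simp add: sum_subtractf I_def)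
      also have "c (1, 1) s = 1"
        using Gal_character_norm[OF \<Gamma> g that, of 1] l complex_norm_square[of "s (g 1) / g 1"] by (simp add: c_def)
      also have "(\<Sum>i\<in>I. a (fst i) * s (g (fst i)) * cnj (a (snd i) * s (g (snd i)))) = s x * cnj (s x)"
        unfolding sx[OF that] cnj_sum sum_product I_def
        by (simp add: sum.cartesian_product case_prod_unfold)
      finally show ?thesis using complex_norm_square[of "s x"] by simp
    qed
    show "2 ^ card I * card {z \<in> ?O. \<bar>(cmod z)\<^sup>2 - 1\<bar> > \<delta>} < card ((\<lambda>s. s x) ` ?G)"
      using order_le_less_trans[OF mult_le_mono1[OF le] card] by (simp only: gamma_orbit_eq)
    show "cmod (of_real ((cmod (s x))\<^sup>2 - 1)) \<le> \<delta>"
      if "s \<in> ?G" "s x \<notin> {z \<in> ?O. \<bar>(cmod z)\<^sup>2 - 1\<bar> > \<delta>}" for s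
      using that unfolding norm_of_real by (auto simp: gamma_orbit_eq)
  qed (use s fin in \<open>auto simp: I_def gamma_orbit_eq intro: Gal_comp\<close>)
  \<comment> \<open>The resulting constant depends only on \<open>N\<close>, not on the chosen
    decomposition; this makes the bound uniform along a sequence.\<close>
  also have "\<dots> \<le> 2 ^ N\<^sup>2 * \<delta>"
    using le_real \<delta> by (intro mult_right_mono) linarith+
  finally show "\<bar>(cmod z)\<^sup>2 - 1\<bar> \<le> 2 ^ N\<^sup>2 * \<delta>" unfolding norm_of_real s(2) .
qed

section \<open>From density close to 1 to density 1\<close>

theorem theorem1p6:
  fixes \<Gamma> :: "complex set" and N :: nat and y :: "nat \<Rightarrow> complex"
  assumes "fin_gen_subgroup \<Gamma> Qbar_star"
    and "N \<ge> 1"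
    and "\<And>n. y n \<in> length_le N \<Gamma>"
    and "\<And>\<epsilon>. \<epsilon> > 0 \<Longrightarrow> (\<lambda>n. gamma_density \<Gamma> \<epsilon> (y n)) \<longlonglongrightarrow> 1"
  shows "\<forall>\<epsilon>>0. \<exists>n0. \<forall>n\<ge>n0. gamma_density \<Gamma> \<epsilon> (y n) = 1"
proof (intro allI impI)
  fix \<epsilon> :: real assume "\<epsilon> > 0"
  have \<Gamma>: "subgroup \<Gamma> Qbar_star" using assms(1) by (simp add: fin_gen_subgroup_def)
  define M :: real where "M = 2 ^ N\<^sup>2"
  \<comment> \<open>Rigidity loses a factor \<open>M\<close>, so the density hypothesis is applied
    at the smaller tolerance \<open>\<delta>\<close> with
    \<open>M * \<delta> = \<epsilon>\<close>.\<close>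
  define \<delta> where "\<delta> = \<epsilon> / M"
  have M: "M > 0" by (simp add: M_def)
  have \<delta>: "\<delta> > 0" "M * \<delta> = \<epsilon>" using M \<open>\<epsilon> > 0\<close> by (simp_all add: \<delta>_def)
  \<comment> \<open>The threshold \<open>1 - 1 / M\<close> leaves a proportion below
    \<open>1 / M\<close> of exceptional conjugates, as rigidity requires.\<close>
  have "eventually (\<lambda>n. gamma_density \<Gamma> \<delta> (y n) > 1 - 1 / M) sequentially"
    using M by (intro order_tendstoD(1)[OF assms(4)[OF \<delta>(1)]]) simp
  then obtain n0 where n0: "\<And>n. n \<ge> n0 \<Longrightarrow> gamma_density \<Gamma> \<delta> (y n) > 1 - 1 / M"
    by (auto simp: eventually_sequentially)
  have "gamma_density \<Gamma> \<epsilon> (y n) = 1" if "n \<ge> n0" for n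
  proof -
    let ?O = "gamma_orbit \<Gamma> (y n)"
    let ?E = "{z \<in> ?O. 1 - \<delta> \<le> (cmod z)\<^sup>2 \<and> (cmod z)\<^sup>2 \<le> 1 + \<delta>}"
    let ?B = "{z \<in> ?O. \<bar>(cmod z)\<^sup>2 - 1\<bar> > \<delta>}"
    \<comment> \<open>With the orbit finite and nonempty, \<open>card\<close> really counts and the
      quotient of cardinalities has a positive denominator.\<close>
    have fin: "finite ?O" using finite_gamma_orbit[OF \<Gamma> assms(3)] .
    have ne: "?O \<noteq> {}" using Gal_id by (auto simp: gamma_orbit_eq)
    have pos: "card ?O > 0" using fin ne by (simp add: card_gt_0_iff)
    have "?O = ?E \<union> ?B" by (auto simp: abs_if)
    then have "card ?O = card (?E \<union> ?B)" by (rule arg_cong)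
    also have "\<dots> = card ?E + card ?B"
      using fin by (intro card_Un_disjoint) (auto simp: abs_if)
    finally have "card ?O = card ?E + card ?B" .
    moreover have "(1 - 1 / M) * card ?O < card ?E"
      using n0[OF that] pos by (simp add: gamma_density_def pos_less_divide_eq)
    ultimately have "M * card ?B < card ?O"
      using M by (simp add: field_simps)
    then have "real (2 ^ N\<^sup>2 * card ?B) < real (card ?O)" by (simp add: M_def)
    then have "2 ^ N\<^sup>2 * card ?B < card ?O" by (simp only: of_nat_less_iff)
    from gamma_orbit_rigid[OF \<Gamma> assms(3) this] have "\<bar>(cmod z)\<^sup>2 - 1\<bar> \<le> \<epsilon>" if "z \<in> ?O" for z
      using that \<delta> by (simp add: M_def)
    then have "{z \<in> ?O. 1 - \<epsilon> \<le> (cmod z)\<^sup>2 \<and> (cmod z)\<^sup>2 \<le> 1 + \<epsilon>} = ?O"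
      by (auto simp: abs_le_iff algebra_simps)
    then show ?thesis using pos by (simp add: gamma_density_def)
  qed
  then show "\<exists>n0. \<forall>n\<ge>n0. gamma_density \<Gamma> \<epsilon> (y n) = 1" by blast
qed

end
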